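(* Let $\widetilde U=(\widetilde U_1,\widetilde U_2)$ and $\widehat U=(\widehat U_1,\widehat U_2)$ be, respectively, ordered upper and lower solutions of the nonlinear difference scheme (defined in the context). Assume that the functions $f_\alpha$, $\alpha=1,2$, satisfy $$\frac{\partial f_\alpha(x_i,y_j,U)}{\partial u_\alpha}\le c_\alpha(x_i,y_j),\qquad -\frac{\partial f_\alpha(x_i,y_j,U)}{\partial u_{\alpha'}}\ge 0,\qquad U\in\langle\widehat U,\widetilde U\rangle,\ (x_i,y_j)\in\overline\Omega^h,\ \alpha'\ne\alpha,\ \alpha=1,2,$$ where $c_\alpha$ are non-negative bounded functions on $\overline\Omega^h$. Suppose that $\{(\overline U^{(n)}_{\alpha,i})_J,(\underline U^{(n)}_{\alpha,i})_J\}$ and $\{(\overline U^{(n)}_{\alpha,i})_{GS},(\underline U^{(n)}_{\alpha,i})_{GS}\}$, $i=0,1,\dots,N_x$, $\alpha=1,2$, are the sequences generated, respectively, by the block Jacobi method and the block Gauss--Seidel method (both defined in the context), where $(\overline U^{(0)})_J=(\overline U^{(0)})_{GS}=\widetilde U$ and $(\underline U^{(0)})_J=(\underline U^{(0)})_{GS}=\widehat U$. Then for all $n$ $$(\underline U^{(n)}_{\alpha,i})_J\le(\underline U^{(n)}_{\alpha,i})_{GS}\le(\overline U^{(n)}_{\alpha,i})_{GS}\le(\overline U^{(n)}_{\alpha,i})_J,\qquad i=0,1,\dots,N_x,\ \alpha=1,2.$$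
   Context: Let $\omega=(0,1)\times(0,1)$, let $\varepsilon_1,\varepsilon_2>0$ be constants, and let $v_\alpha(x,y)\ge0$ on $\overline\omega$, $f_\alpha(x,y,u)$ with $u=(u_1,u_2)$, and $g=(g_1,g_2)$ (boundary data), $\alpha=1,2$, be smooth functions. All inequalities between vectors, vector functions and matrices are understood componentwise (entrywise). Mesh: $\overline\Omega^h=\{(x_i,y_j):0\le i\le N_x,\ 0\le j\le N_y\}$ with $x_i=ih_x$, $y_j=jh_y$, $h_x=1/N_x$, $h_y=1/N_y$; $\Omega^h$ is the set of interior mesh points ($1\le i\le N_x-1$, $1\le j\le N_y-1$) and $\partial\Omega^h=\overline\Omega^h\setminus\Omega^h$. For a mesh function $U=(U_1,U_2)$ put $U_{\alpha,ij}=U_\alpha(x_i,y_j)$. For an interior mesh point define $$\mathcal L_{\alpha,ij}U_\alpha(x_i,y_j)=-\varepsilon_\alpha\left(\frac{U_{\alpha,i-1,j}-2U_{\alpha,ij}+U_{\alpha,i+1,j}}{h_x^2}+\frac{U_{\alpha,i,j-1}-2U_{\alpha,ij}+U_{\alpha,i,j+1}}{h_y^2}\right)+v_\alpha(x_i,y_j)\left(\frac{U_{\alpha,ij}-U_{\alpha,i-1,j}}{h_x}+\frac{U_{\alpha,ij}-U_{\alpha,i,j-1}}{h_y}\right).$$ The nonlinear difference scheme is $$\mathcal L_{\alpha,ij}U_\alpha(x_i,y_j)+f_\alpha(x_i,y_j,U)=0,\ (x_i,y_j)\in\Omega^h,\ \alpha=1,2;\qquad U(x_i,y_j)=g(x_i,y_j),\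 (x_i,y_j)\in\partial\Omega^h.$$ Mesh functions $\widetilde U=(\widetilde U_1,\widetilde U_2)$ and $\widehat U=(\widehat U_1,\widehat U_2)$ are ordered upper and lower solutions of this scheme if $\widetilde U\ge\widehat U$ on $\overline\Omega^h$; $\mathcal L_{\alpha,ij}\widetilde U_\alpha(x_i,y_j)+f_\alpha(x_i,y_j,\widetilde U)\ge0$ and $\mathcal L_{\alpha,ij}\widehat U_\alpha(x_i,y_j)+f_\alpha(x_i,y_j,\widehat U)\le0$ on $\Omega^h$ for $\alpha=1,2$; and $\widehat U\le g\le\widetilde U$ on $\partial\Omega^h$. The sector is $\langle\widehat U,\widetilde U\rangle=\{U:\widehat U\le U\le\widetilde U\text{ on }\overline\Omega^h\}$. Block form. Put $l_{\alpha,ij}=\varepsilon_\alpha/h_x^2+v_\alpha(x_i,y_j)/h_x$, $r_{\alpha,ij}=\varepsilon_\alpha/h_x^2$, $b_{\alpha,ij}=\varepsilon_\alpha/h_y^2+v_\alpha(x_i,y_j)/h_y$, $t_{\alpha,ij}=\varepsilon_\alpha/h_y^2$, $d_{\alpha,ij}=l_{\alpha,ij}+r_{\alpha,ij}+b_{\alpha,ij}+t_{\alpha,ij}$. For $i=0,\dots,N_x$ let $U_{\alpha,i}=(U_{\alpha,i,1},\dots,U_{\alpha,i,N_y-1})^T$, $U_i=(U_{1,i},U_{2,i})$ and $g_{\alpha,i}=(g_\alpha(x_i,y_1),\dots,g_\alpha(x_i,y_{N_y-1}))^T$ (for $i=0,N_x$). For $1\le i\le N_x-1$ let $L_{\alpha,i}=\mathrm{diag}(l_{\alpha,i,1},\dots,l_{\alpha,i,N_y-1})$,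 $R_{\alpha,i}=\mathrm{diag}(r_{\alpha,i,1},\dots,r_{\alpha,i,N_y-1})$, $C_{\alpha,i}=\mathrm{diag}(c_\alpha(x_i,y_1),\dots,c_\alpha(x_i,y_{N_y-1}))$ with $c_\alpha$ the functions bounding $\partial f_\alpha/\partial u_\alpha$; let $A_{\alpha,i}$ be the tridiagonal matrix with diagonal entries $d_{\alpha,ij}$ in row $j$, subdiagonal entries $-b_{\alpha,ij}$ in row $j$ ($j=2,\dots,N_y-1$), and superdiagonal entries $-t_{\alpha,ij}$ in row $j$ ($j=1,\dots,N_y-2$); let $F_{\alpha,i}(U_i)$ be the vector with entries $f_\alpha(x_i,y_j,U_{1,ij},U_{2,ij})$, $j=1,\dots,N_y-1$; and let $G^*_{\alpha,i}$ be the vector of boundary contributions from $y=0$ and $y=1$, i.e. with $b_{\alpha,i,1}g_\alpha(x_i,0)$ added to its first entry and $t_{\alpha,i,N_y-1}g_\alpha(x_i,1)$ added to its last entry, all other contributions being zero. Define the residual, for $1\le i\le N_x-1$, $$\mathcal K_{\alpha,i}(U_i)=A_{\alpha,i}U_{\alpha,i}-L_{\alpha,i}U_{\alpha,i-1}-R_{\alpha,i}U_{\alpha,i+1}+F_{\alpha,i}(U_i)-G^*_{\alpha,i}.$$ In both methods, given $U^{(0)}$, for $n\ge1$ and $\alpha=1,2$ one sets $U^{(n)}_{\alpha,i}=U^{(n-1)}_{\alpha,i}+Z^{(n)}_{\alpha,i}$, with $Z^{(1)}_{\alpha,i}=g_{\alpha,i}-U^{(0)}_{\alpha,i}$ and $Z^{(n)}_{\alpha,i}=\mathbf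 0$ ($n\ge2$) for $i=0,N_x$. For $i=1,\dots,N_x-1$: Block Jacobi method: $A_{\alpha,i}Z^{(n)}_{\alpha,i}+C_{\alpha,i}Z^{(n)}_{\alpha,i}=-\mathcal K_{\alpha,i}(U^{(n-1)}_i)$. Block Gauss--Seidel method: $A_{\alpha,i}Z^{(n)}_{\alpha,i}-L_{\alpha,i}Z^{(n)}_{\alpha,i-1}+C_{\alpha,i}Z^{(n)}_{\alpha,i}=-\mathcal K_{\alpha,i}(U^{(n-1)}_i)$. *)

theory Defs
  imports "HOL-Analysis.Analysis" "Jordan_Normal_Form.Matrix"
begin

text \<open>Both imports use the infix \<open>$\<close>; below it always means \<^const>\<open>Matrix.vec_index\<close>.\<close>

no_notation vec_nth (infixl "$" 90)

section \<open>Smooth functions\<close>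

text \<open>On an open set of a finite-dimensional space this is \<open>C^k\<close>: all iterated directional
  derivatives up to order \<open>k\<close> exist and are continuous.\<close>

primrec Ck_on ::
  "nat \<Rightarrow> ('a::euclidean_space \<Rightarrow> 'b::euclidean_space) \<Rightarrow> 'a set \<Rightarrow> bool" where
  "Ck_on 0 F S \<longleftrightarrow> continuous_on S F"
| "Ck_on (Suc k) F S \<longleftrightarrow>
     (\<forall>z\<in>S. F differentiable (at z)) \<and>
     (\<forall>w. Ck_on k (\<lambda>z. frechet_derivative F (at z) w) S)"

text \<open>On an arbitrary set: restriction of a \<open>C^\<infinity>\<close> function defined on an open
  neighbourhood.\<close>

definition smooth_on ::
  "('a::euclidean_space \<Rightarrow> 'b::euclidean_space) \<Rightarrow> 'a set \<Rightarrow> bool" where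
  "smooth_on F S \<longleftrightarrow>
     (\<exists>T G. open T \<and> S \<subseteq> T \<and> (\<forall>k. Ck_on k G T) \<and> (\<forall>z\<in>S. G z = F z))"

section \<open>Data of the problem\<close>

text \<open>The index \<open>\<alpha> = 1, 2\<close> of a component ranges over the two-element type \<open>2\<close>, whose
  elements are \<open>1\<close> and \<open>2 = 0\<close>.\<close>

definition omega :: "(real \<times> real) set" where
  "omega = {0<..<1} \<times> {0<..<1}"

text \<open>\<open>\<partial>f/\<partial>u\<^sub>\<beta>\<close> at the point \<open>(x, y, u)\<close>, with \<open>p = (x, y)\<close>.\<close>

definition partial_u ::
  "(real \<times> real \<times> (real^2) \<Rightarrow> real) \<Rightarrow> 2 \<Rightarrow> real \<times> real \<Rightarrow> real^2 \<Rightarrow> real" where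
  "partial_u F \<beta> p u = deriv (\<lambda>s. F (fst p, snd p, u + s *\<^sub>R axis \<beta> 1)) 0"

text \<open>\<open>U \<alpha> i j\<close> is the value of the component \<open>\<alpha>\<close> at the mesh point \<open>(x\<^sub>i, y\<^sub>j)\<close>. Only the
  values with \<open>i \<le> N\<^sub>x\<close> and \<open>j \<le> N\<^sub>y\<close> are relevant.\<close>

type_synonym mesh_fun = "2 \<Rightarrow> nat \<Rightarrow> nat \<Rightarrow> real"

text \<open>\<open>V \<alpha> i\<close> is the block \<open>(V\<^bsub>\<alpha>,i,1\<^esub>, \<dots>, V\<^bsub>\<alpha>,i,Ny-1\<^esub>)\<^sup>T\<close>. Vector and matrix indices start
  at \<open>0\<close>, so the vector index \<open>k\<close> belongs to the mesh index \<open>j = k + 1\<close>.\<close>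

type_synonym block_fun = "2 \<Rightarrow> nat \<Rightarrow> real Matrix.vec"

section \<open>The nonlinear difference scheme\<close>

context
  fixes Nx Ny :: nat
    and eps :: "2 \<Rightarrow> real"
    and v :: "2 \<Rightarrow> real \<times> real \<Rightarrow> real"
    and f :: "2 \<Rightarrow> real \<times> real \<times> (real^2) \<Rightarrow> real"
    and g :: "2 \<Rightarrow> real \<times> real \<Rightarrow> real"
    and c :: "2 \<Rightarrow> nat \<Rightarrow> nat \<Rightarrow> real"
begin

definition hx :: real where "hx = 1 / real Nx"
definition hy :: real where "hy = 1 / real Ny"

definition xm :: "nat \<Rightarrow> real" where "xm i = real i * hx"
definition ym :: "nat \<Rightarrow> real" where "ym j = real j * hy"

definition mesh :: "(nat \<times> nat) set" where
  "mesh = {0..Nx} \<times> {0..Ny}"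

definition interior_mesh :: "(nat \<times> nat) set" where
  "interior_mesh = {1..Nx - 1} \<times> {1..Ny - 1}"

definition boundary_mesh :: "(nat \<times> nat) set" where
  "boundary_mesh = mesh - interior_mesh"

definition diff_op :: "2 \<Rightarrow> (nat \<Rightarrow> nat \<Rightarrow> real) \<Rightarrow> nat \<Rightarrow> nat \<Rightarrow> real" where
  "diff_op \<alpha> W i j =
     - eps \<alpha> * ((W (i - 1) j - 2 * W i j + W (i + 1) j) / hx\<^sup>2
               + (W i (j - 1) - 2 * W i j + W i (j + 1)) / hy\<^sup>2)
     + v \<alpha> (xm i, ym j) * ((W i j - W (i - 1) j) / hx + (W i j - W i (j - 1)) / hy)"

definition f_mesh :: "2 \<Rightarrow> mesh_fun \<Rightarrow> nat \<Rightarrow> nat \<Rightarrow> real" where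
  "f_mesh \<alpha> U i j = f \<alpha> (xm i, ym j, \<chi> \<beta>. U \<beta> i j)"

definition ordered_upper_lower :: "mesh_fun \<Rightarrow> mesh_fun \<Rightarrow> bool" where
  "ordered_upper_lower Ut Uh \<longleftrightarrow>
     (\<forall>(i, j)\<in>mesh. \<forall>\<alpha>. Uh \<alpha> i j \<le> Ut \<alpha> i j) \<and>
     (\<forall>(i, j)\<in>interior_mesh. \<forall>\<alpha>.
        diff_op \<alpha> (Ut \<alpha>) i j + f_mesh \<alpha> Ut i j \<ge> 0 \<and>
        diff_op \<alpha> (Uh \<alpha>) i j + f_mesh \<alpha> Uh i j \<le> 0) \<and>
     (\<forall>(i, j)\<in>boundary_mesh. \<forall>\<alpha>.
        Uh \<alpha> i j \<le> g \<alpha> (xm i, ym j) \<and> g \<alpha> (xm i, ym j) \<le> Ut \<alpha> i j)"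

definition sector :: "mesh_fun \<Rightarrow> mesh_fun \<Rightarrow> mesh_fun set" where
  "sector Uh Ut =
     {U. \<forall>(i, j)\<in>mesh. \<forall>\<alpha>. Uh \<alpha> i j \<le> U \<alpha> i j \<and> U \<alpha> i j \<le> Ut \<alpha> i j}"

section \<open>Block form\<close>

definition l_coef :: "2 \<Rightarrow> nat \<Rightarrow> nat \<Rightarrow> real" where
  "l_coef \<alpha> i j = eps \<alpha> / hx\<^sup>2 + v \<alpha> (xm i, ym j) / hx"

definition r_coef :: "2 \<Rightarrow> nat \<Rightarrow> nat \<Rightarrow> real" where
  "r_coef \<alpha> i j = eps \<alpha> / hx\<^sup>2"

definition b_coef :: "2 \<Rightarrow> nat \<Rightarrow> nat \<Rightarrow> real" where
  "b_coef \<alpha> i j = eps \<alpha> / hy\<^sup>2 + v \<alpha> (xm i, ym j) / hy"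

definition t_coef :: "2 \<Rightarrow> nat \<Rightarrow> nat \<Rightarrow> real" where
  "t_coef \<alpha> i j = eps \<alpha> / hy\<^sup>2"

definition d_coef :: "2 \<Rightarrow> nat \<Rightarrow> nat \<Rightarrow> real" where
  "d_coef \<alpha> i j = l_coef \<alpha> i j + r_coef \<alpha> i j + b_coef \<alpha> i j + t_coef \<alpha> i j"

definition block :: "(nat \<Rightarrow> real) \<Rightarrow> real Matrix.vec" where
  "block w = Matrix.vec (Ny - 1) (\<lambda>k. w (k + 1))"

definition diag_block :: "(nat \<Rightarrow> real) \<Rightarrow> real Matrix.mat" where
  "diag_block w = mat_diag (Ny - 1) (\<lambda>k. w (k + 1))"

definition L_mat :: "2 \<Rightarrow> nat \<Rightarrow> real Matrix.mat" where
  "L_mat \<alpha> i = diag_block (l_coef \<alpha> i)"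

definition R_mat :: "2 \<Rightarrow> nat \<Rightarrow> real Matrix.mat" where
  "R_mat \<alpha> i = diag_block (r_coef \<alpha> i)"

definition C_mat :: "2 \<Rightarrow> nat \<Rightarrow> real Matrix.mat" where
  "C_mat \<alpha> i = diag_block (c \<alpha> i)"

definition A_mat :: "2 \<Rightarrow> nat \<Rightarrow> real Matrix.mat" where
  "A_mat \<alpha> i = Matrix.mat (Ny - 1) (Ny - 1) (\<lambda>(k, m).
     if m = k then d_coef \<alpha> i (k + 1)
     else if m + 1 = k then - b_coef \<alpha> i (k + 1)
     else if m = k + 1 then - t_coef \<alpha> i (k + 1)
     else 0)"

definition g_block :: "2 \<Rightarrow> nat \<Rightarrow> real Matrix.vec" where
  "g_block \<alpha> i = block (\<lambda>j. g \<alpha> (xm i, ym j))"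

definition F_block :: "2 \<Rightarrow> nat \<Rightarrow> block_fun \<Rightarrow> real Matrix.vec" where
  "F_block \<alpha> i U =
     Matrix.vec (Ny - 1) (\<lambda>k. f \<alpha> (xm i, ym (k + 1), \<chi> \<beta>. U \<beta> i $ k))"

text \<open>If \<open>N\<^sub>y = 2\<close>, the first and the last entry coincide and receive both contributions.\<close>

definition G_star :: "2 \<Rightarrow> nat \<Rightarrow> real Matrix.vec" where
  "G_star \<alpha> i = block (\<lambda>j.
     (if j = 1 then b_coef \<alpha> i 1 * g \<alpha> (xm i, 0) else 0) +
     (if j = Ny - 1 then t_coef \<alpha> i (Ny - 1) * g \<alpha> (xm i, 1) else 0))"

text \<open>The residual \<open>\<K>\<^bsub>\<alpha>,i\<^esub>(U\<^sub>i)\<close>; besides \<open>U\<^sub>i\<close> it involves the neighbouring blocks, so it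
  takes the whole block function.\<close>

definition residual :: "2 \<Rightarrow> nat \<Rightarrow> block_fun \<Rightarrow> real Matrix.vec" where
  "residual \<alpha> i U =
     A_mat \<alpha> i *\<^sub>v U \<alpha> i - L_mat \<alpha> i *\<^sub>v U \<alpha> (i - 1) - R_mat \<alpha> i *\<^sub>v U \<alpha> (i + 1)
     + F_block \<alpha> i U - G_star \<alpha> i"

section \<open>The block iterations\<close>

definition initial_blocks :: "mesh_fun \<Rightarrow> (nat \<Rightarrow> block_fun) \<Rightarrow> bool" where
  "initial_blocks W U \<longleftrightarrow> (\<forall>\<alpha>. \<forall>i\<le>Nx. U 0 \<alpha> i = block (W \<alpha> i))"

text \<open>The part common to both methods: \<open>Z n\<close> is the \<open>n\<close>-th increment (\<open>n \<ge> 1\<close>), prescribed on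
  the blocks \<open>i = 0\<close> and \<open>i = N\<^sub>x\<close>.\<close>

definition increments :: "(nat \<Rightarrow> block_fun) \<Rightarrow> (nat \<Rightarrow> block_fun) \<Rightarrow> bool" where
  "increments U Z \<longleftrightarrow> (\<forall>n\<ge>1. \<forall>\<alpha>.
     (\<forall>i\<le>Nx. Z n \<alpha> i \<in> carrier_vec (Ny - 1) \<and> U n \<alpha> i = U (n - 1) \<alpha> i + Z n \<alpha> i) \<and>
     (\<forall>i\<in>{0, Nx}. Z n \<alpha> i = (if n = 1 then g_block \<alpha> i - U 0 \<alpha> i else 0\<^sub>v (Ny - 1))))"

definition block_jacobi :: "mesh_fun \<Rightarrow> (nat \<Rightarrow> block_fun) \<Rightarrow> bool" where
  "block_jacobi W U \<longleftrightarrow> initial_blocks W U \<and> (\<exists>Z. increments U Z \<and>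
     (\<forall>n\<ge>1. \<forall>\<alpha>. \<forall>i\<in>{1..Nx - 1}.
        A_mat \<alpha> i *\<^sub>v Z n \<alpha> i + C_mat \<alpha> i *\<^sub>v Z n \<alpha> i = - residual \<alpha> i (U (n - 1))))"

definition block_gauss_seidel :: "mesh_fun \<Rightarrow> (nat \<Rightarrow> block_fun) \<Rightarrow> bool" where
  "block_gauss_seidel W U \<longleftrightarrow> initial_blocks W U \<and> (\<exists>Z. increments U Z \<and>
     (\<forall>n\<ge>1. \<forall>\<alpha>. \<forall>i\<in>{1..Nx - 1}.
        A_mat \<alpha> i *\<^sub>v Z n \<alpha> i - L_mat \<alpha> i *\<^sub>v Z n \<alpha> (i - 1) + C_mat \<alpha> i *\<^sub>v Z n \<alpha> i
          = - residual \<alpha> i (U (n - 1))))"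

end

end

theory Submission
  imports Defs
begin

text \<open>Adding \<open>C U\<^bsub>n\<^esub>\<close> to both sides turns either method into a fixed-point iteration
  \<open>(A + C) U\<^bsub>n+1\<^esub> = L Y + R U\<^bsub>n\<^esub> + (C U\<^bsub>n\<^esub> - F(U\<^bsub>n\<^esub>)) + G\<^sup>*\<close> with \<open>Y = U\<^bsub>n\<^esub>\<close> (Jacobi) or
  \<open>Y = U\<^bsub>n+1\<^esub>\<close> (Gauss--Seidel). The discrete maximum principle makes \<open>A + C\<close> inverse monotone
  and the derivative bounds make \<open>C U - F(U)\<close> monotone on the sector, so the right-hand side is
  monotone in all of its arguments. Hence upper sequences decrease, lower ones increase, and
  they stay ordered. For the upper sequences, the Gauss--Seidel iterate \<open>n+1\<close> lies below the
  Gauss--Seidel iterate \<open>n\<close> and hence, inductively, below the Jacobi iterate \<open>n\<close>, so the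
  Gauss--Seidel step has the smaller right-hand side.\<close>

section \<open>Derivatives along lines in \<open>u\<close>, and tridiagonal sums\<close>

text \<open>Chain rule for a smooth extension \<open>G\<close>, transferred to \<open>F\<close>: the
  domain restricts only \<open>(x, y)\<close>, so \<open>F\<close> and \<open>G\<close> agree on
  every line in a \<open>u\<close> direction, even when \<open>p\<close> lies on the boundary of
  \<open>S\<close>.\<close>

lemma smooth_on_line_derivative:
  fixes F :: "real \<times> real \<times> (real^2) \<Rightarrow> real"
  assumes "smooth_on F {(x, y, u). (x, y) \<in> S}" and p: "p \<in> S"
  shows "((\<lambda>s. F (fst p, snd p, u + s *\<^sub>R w)) has_real_derivative
           (\<Sum>\<beta>\<in>UNIV. vec_nth w \<beta> * partial_u F \<beta> p (u + s *\<^sub>R w))) (at s)"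
proof -
  obtain T G where T: "open T" "{(x, y, u). (x, y) \<in> S} \<subseteq> T" "\<forall>k. Ck_on k G T"
    and GF: "\<forall>z\<in>{(x, y, u). (x, y) \<in> S}. G z = F z"
    using assms(1) unfolding smooth_on_def by blast
  have GFp: "F (fst p, snd p, q) = G (fst p, snd p, q)" for q
    using GF p by (auto simp: split_beta)
  define D where "D = frechet_derivative G (at (fst p, snd p, u + s *\<^sub>R w))"
  have "Ck_on (Suc 0) G T" using T(3) by blast
  moreover have "(fst p, snd p, u + s *\<^sub>R w) \<in> T" using T(2) p by auto
  ultimately have "(G has_derivative D) (at (fst p, snd p, u + s *\<^sub>R w))"
    unfolding D_def by (auto simp: frechet_derivative_works)
  \<comment> \<open>The set \<open>X\<close> is left arbitrary because the chain rule asks for the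
    derivative within the image of the line.\<close>
  then have dG: "(G has_derivative D) (at (fst p, snd p, u + s *\<^sub>R w) within X)" for X
    by (rule has_derivative_at_withinI)
  have lin: "linear D" using dG by (rule has_derivative_linear)
  \<comment> \<open>Stated for general \<open>q\<close>, \<open>e\<close>, \<open>s'\<close> since
    it serves twice: for the line in direction \<open>w\<close> at \<open>s\<close>, and for the
    partial derivatives, with \<open>e = axis \<beta> 1\<close> and \<open>s' = 0\<close>.\<close>
  have dir: "((\<lambda>s'. G (fst p, snd p, q + s' *\<^sub>R e)) has_real_derivative D (0, 0, e)) (at s')"
    if "q + s' *\<^sub>R e = u + s *\<^sub>R w" for q e s'
  proof -
    have "((\<lambda>s'. (fst p, snd p, q + s' *\<^sub>R e)) has_derivative (\<lambda>h. (0, 0, h *\<^sub>R e))) (at s')"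
      by (auto intro!: derivative_eq_intros)
    from diff_chain_within[OF this, of G D] dG that
    have "((\<lambda>s'. G (fst p, snd p, q + s' *\<^sub>R e)) has_derivative (\<lambda>h. D (0, 0, h *\<^sub>R e))) (at s')"
      by (simp add: o_def)
    moreover have "D (0, 0, h *\<^sub>R e) = D (0, 0, e) * h" for h
      using linear_scale[OF lin, of h "(0, 0, e)"] by simp
    ultimately show ?thesis by (simp add: has_field_derivative_def)
  qed
  have part: "partial_u F \<beta> p (u + s *\<^sub>R w) = D (0, 0, axis \<beta> 1)" for \<beta>
    unfolding partial_u_def GFp by (rule DERIV_imp_deriv, rule dir) simp
  have "D (0, 0, w) = D (\<Sum>\<beta>\<in>UNIV. vec_nth w \<beta> *\<^sub>R (0, 0, axis \<beta> 1))"
  proof (rule arg_cong[of _ _ D], intro prod_eqI)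
    show "snd (snd (0 :: real, 0 :: real, w)) =
        snd (snd (\<Sum>\<beta>\<in>UNIV. vec_nth w \<beta> *\<^sub>R (0 :: real, 0 :: real, axis \<beta> (1::real))))"
      by (simp add: snd_sum Finite_Cartesian_Product.vec_eq_iff axis_def if_distrib cong: if_cong)
  qed (simp_all add: snd_sum fst_sum)
  also have "\<dots> = (\<Sum>\<beta>\<in>UNIV. vec_nth w \<beta> * D (0, 0, axis \<beta> 1))"
    by (simp add: linear_sum[OF lin] linear_scale[OF lin] del: scaleR_Pair)
  finally show ?thesis using dir[OF refl] part by (simp add: GFp)
qed

lemma tridiag_sum:
  fixes z :: "nat \<Rightarrow> real"
  assumes "k < N"
  shows "(\<Sum>m = 0..<N. (if m = k then d else if m + 1 = k then - b
           else if m = k + 1 then - t else 0) * z m) =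
         d * z k - (if k = 0 then 0 else b * z (k - 1)) - (if k = N - 1 then 0 else t * z (k + 1))"
proof -
  \<comment> \<open>The nested conditional splits into three disjoint indicators; the guard
    \<open>k \<noteq> 0\<close> is there because \<open>k - 1\<close> truncates at zero.\<close>
  have "(\<Sum>m = 0..<N. (if m = k then d else if m + 1 = k then - b
           else if m = k + 1 then - t else 0) * z m) =
      (\<Sum>m = 0..<N. (if m = k then d * z m else 0) - (if k \<noteq> 0 \<and> m = k - 1 then b * z m else 0)
         - (if m = k + 1 then t * z m else 0))"
    by (intro sum.cong) auto
  also have "\<dots> = d * z k - (if k = 0 then 0 else b * z (k - 1))
      - (if k = N - 1 then 0 else t * z (k + 1))"
    using assms by (cases "k = 0") (auto simp: sum_subtractf)
  finally show ?thesis .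
qed

text \<open>Completes a block function by the boundary data on \<open>y = 0\<close> and \<open>y = 1\<close>, which absorbs \<open>G\<^sup>*\<close>.\<close>

definition extend :: "nat \<Rightarrow> nat \<Rightarrow> (2 \<Rightarrow> real \<times> real \<Rightarrow> real) \<Rightarrow> block_fun \<Rightarrow> mesh_fun" where
  "extend Nx Ny g U \<alpha> i j =
     (if j = 0 \<or> j = Ny then g \<alpha> (xm Nx i, ym Ny j) else U \<alpha> i $ (j - 1))"

section \<open>Problem data and the pointwise form of the iterations\<close>

text \<open>Only the data and the pair \<open>Ut\<close>, \<open>Uh\<close> are fixed; iterates
  remain variables, so that each lemma serves all four sequences.\<close>

locale block_scheme =
  fixes Nx Ny :: nat
    and eps :: "2 \<Rightarrow> real"
    and v :: "2 \<Rightarrow> real \<times> real \<Rightarrow> real"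
    and f :: "2 \<Rightarrow> real \<times> real \<times> (real^2) \<Rightarrow> real"
    and g :: "2 \<Rightarrow> real \<times> real \<Rightarrow> real"
    and c :: "2 \<Rightarrow> nat \<Rightarrow> nat \<Rightarrow> real"
    and Ut Uh :: mesh_fun
  assumes Nx: "Nx \<ge> 1" and Ny: "Ny \<ge> 1"
    and eps: "\<And>\<alpha>. eps \<alpha> > 0"
    and v: "\<And>\<alpha> p. p \<in> closure omega \<Longrightarrow> v \<alpha> p \<ge> 0"
    and f_smooth: "\<And>\<alpha>. smooth_on (f \<alpha>) {(x, y, u). (x, y) \<in> closure omega}"
    and upper_lower: "ordered_upper_lower Nx Ny eps v f g Ut Uh"
    and c: "\<And>\<alpha> i j. (i, j) \<in> mesh Nx Ny \<Longrightarrow> c \<alpha> i j \<ge> 0"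
    and f_diag: "\<And>\<alpha> i j U. (i, j) \<in> mesh Nx Ny \<Longrightarrow> U \<in> sector Nx Ny Uh Ut \<Longrightarrow>
           partial_u (f \<alpha>) \<alpha> (xm Nx i, ym Ny j) (\<chi> \<beta>. U \<beta> i j) \<le> c \<alpha> i j"
    and f_offdiag: "\<And>\<alpha> \<alpha>' i j U. (i, j) \<in> mesh Nx Ny \<Longrightarrow> U \<in> sector Nx Ny Uh Ut \<Longrightarrow> \<alpha>' \<noteq> \<alpha> \<Longrightarrow>
           - partial_u (f \<alpha>) \<alpha>' (xm Nx i, ym Ny j) (\<chi> \<beta>. U \<beta> i j) \<ge> 0"
begin

abbreviation "ll \<equiv> l_coef Nx Ny eps v"
abbreviation "rr \<equiv> r_coef Nx eps"
abbreviation "bb \<equiv> b_coef Nx Ny eps v"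
abbreviation "tt \<equiv> t_coef Ny eps"
abbreviation "dd \<equiv> d_coef Nx Ny eps v"
abbreviation "ff \<equiv> f_mesh Nx Ny f"
abbreviation "gg \<alpha> i j \<equiv> g \<alpha> (xm Nx i, ym Ny j)"
abbreviation "ext \<equiv> extend Nx Ny g"

text \<open>An entry of \<open>A + C\<close> applied to \<open>X\<close> on the grid line of index
  \<open>i\<close>. The neighbours \<open>j = 0\<close> and \<open>j = Ny\<close> are included, so
  boundary data enter through \<open>X\<close> and no separate \<open>G_star\<close> is
  needed.\<close>

definition lhs :: "2 \<Rightarrow> mesh_fun \<Rightarrow> nat \<Rightarrow> nat \<Rightarrow> real" where
  "lhs \<alpha> X i j = (dd \<alpha> i j + c \<alpha> i j) * X \<alpha> i j - bb \<alpha> i j * X \<alpha> i (j - 1) - tt \<alpha> i j * X \<alpha> i (j + 1)"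

text \<open>\<open>Y\<close> supplies only the left neighbour, the one term in which the two methods
  differ.\<close>

definition rhs :: "2 \<Rightarrow> mesh_fun \<Rightarrow> mesh_fun \<Rightarrow> nat \<Rightarrow> nat \<Rightarrow> real" where
  "rhs \<alpha> Y V i j = ll \<alpha> i j * Y \<alpha> (i - 1) j + rr \<alpha> i j * V \<alpha> (i + 1) j + c \<alpha> i j * V \<alpha> i j - ff \<alpha> V i j"

definition leq :: "mesh_fun \<Rightarrow> mesh_fun \<Rightarrow> bool" where
  "leq X Y \<longleftrightarrow> (\<forall>\<alpha>. \<forall>i\<le>Nx. \<forall>j\<le>Ny. X \<alpha> i j \<le> Y \<alpha> i j)"

definition bdry :: "nat \<Rightarrow> nat \<Rightarrow> bool" where
  "bdry i j \<longleftrightarrow> i \<le> Nx \<and> j \<le> Ny \<and> (i = 0 \<or> i = Nx \<or> j = 0 \<or> j = Ny)"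

definition inner :: "nat \<Rightarrow> nat \<Rightarrow> bool" where
  "inner i j \<longleftrightarrow> 0 < i \<and> i < Nx \<and> 0 < j \<and> j < Ny"

text \<open>Upper solutions in fixed-point form: the terms with \<open>c\<close> on both sides
  cancel, which leaves the difference inequality (see \<open>diff_op_lhs\<close>).\<close>

definition super :: "mesh_fun \<Rightarrow> bool" where
  "super X \<longleftrightarrow> (\<forall>\<alpha> i j. (bdry i j \<longrightarrow> gg \<alpha> i j \<le> X \<alpha> i j) \<and> (inner i j \<longrightarrow> rhs \<alpha> X X i j \<le> lhs \<alpha> X i j))"

definition sub :: "mesh_fun \<Rightarrow> bool" where
  "sub X \<longleftrightarrow> (\<forall>\<alpha> i j. (bdry i j \<longrightarrow> X \<alpha> i j \<le> gg \<alpha> i j) \<and> (inner i j \<longrightarrow> lhs \<alpha> X i j \<le> rhs \<alpha> X X i j))"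

text \<open>One step of the Jacobi (\<open>gs = False\<close>) or the Gauss--Seidel (\<open>gs = True\<close>) method.\<close>

definition step :: "bool \<Rightarrow> mesh_fun \<Rightarrow> mesh_fun \<Rightarrow> bool" where
  "step gs V X \<longleftrightarrow> (\<forall>\<alpha> i j. (bdry i j \<longrightarrow> X \<alpha> i j = gg \<alpha> i j) \<and>
     (inner i j \<longrightarrow> lhs \<alpha> X i j = rhs \<alpha> (if gs then X else V) V i j))"

lemma leq_trans: "leq X Y \<Longrightarrow> leq Y Z \<Longrightarrow> leq X Z"
  unfolding leq_def by (meson order_trans)

lemma leq_refl: "leq X X"
  by (simp add: leq_def)

lemma hx_pos: "hx Nx > 0" and hy_pos: "hy Ny > 0"
  using Nx Ny by (simp_all add: hx_def hy_def)

lemma mesh_point: "i \<le> Nx \<Longrightarrow> j \<le> Ny \<Longrightarrow> (xm Nx i, ym Ny j) \<in> closure omega"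
  using Nx Ny by (auto simp: omega_def closure_Times xm_def ym_def hx_def hy_def field_simps)

lemma coef_nonneg:
  assumes "i \<le> Nx" "j \<le> Ny"
  shows "ll \<alpha> i j \<ge> 0" "rr \<alpha> i j > 0" "bb \<alpha> i j \<ge> 0" "tt \<alpha> i j \<ge> 0" "c \<alpha> i j \<ge> 0"
  using assms eps[of \<alpha>] v[OF mesh_point[OF assms], of \<alpha>] hx_pos hy_pos c[of i j \<alpha>]
  by (auto simp: l_coef_def r_coef_def b_coef_def t_coef_def mesh_def)

lemma Uh_Ut: "leq Uh Ut"
  using upper_lower unfolding ordered_upper_lower_def leq_def by (auto simp: mesh_def)

section \<open>Discrete maximum principle and monotonicity of the right-hand side\<close>

text \<open>At a positive interior maximum of the difference \<open>w\<close>, both neighbours are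
  at most \<open>w k\<close>, so the \<open>b\<close> and \<open>t\<close> parts of the diagonal
  absorb them. What remains is \<open>(l + r + c) * w k \<le> 0\<close>, impossible since
  \<open>r > 0\<close>.\<close>

lemma row_compare:
  assumes i: "0 < i" "i < Nx"
    and ends: "X \<alpha> i 0 \<le> X' \<alpha> i 0" "X \<alpha> i Ny \<le> X' \<alpha> i Ny"
    and le: "\<And>j. 0 < j \<Longrightarrow> j < Ny \<Longrightarrow> lhs \<alpha> X i j \<le> lhs \<alpha> X' i j"
    and j: "j \<le> Ny"
  shows "X \<alpha> i j \<le> X' \<alpha> i j"
proof (rule ccontr)
  assume neg: "\<not> X \<alpha> i j \<le> X' \<alpha> i j"
  define w where "w k = X \<alpha> i k - X' \<alpha> i k" for k
  obtain k where k: "k \<le> Ny" "\<And>m. m \<le> Ny \<Longrightarrow> w m \<le> w k"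
  proof -
    have "Max (w ` {..Ny}) \<in> w ` {..Ny}" by (rule Max_in) auto
    then obtain k where "k \<le> Ny" "Max (w ` {..Ny}) = w k" by (metis atMost_iff imageE)
    moreover have "w m \<le> Max (w ` {..Ny})" if "m \<le> Ny" for m using that by simp
    ultimately show thesis using that by metis
  qed
  have pos: "w k > 0" using k(2)[OF j] neg by (simp add: w_def)
  have "w 0 \<le> 0" "w Ny \<le> 0" using ends by (simp_all add: w_def)
  then have "k \<noteq> 0" "k \<noteq> Ny" using pos by (metis not_less)+
  then have kk: "0 < k" "k < Ny" using k(1) by simp_all
  note co = coef_nonneg[of i k \<alpha>]
  have "(dd \<alpha> i k + c \<alpha> i k) * w k \<le> bb \<alpha> i k * w (k - 1) + tt \<alpha> i k * w (k + 1)"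
    using le[OF kk] by (simp add: lhs_def w_def algebra_simps)
  also have "\<dots> \<le> bb \<alpha> i k * w k + tt \<alpha> i k * w k"
    using co i kk k by (intro add_mono mult_left_mono) auto
  finally have "(ll \<alpha> i k + rr \<alpha> i k + c \<alpha> i k) * w k \<le> 0"
    by (simp add: d_coef_def algebra_simps)
  moreover have "ll \<alpha> i k + rr \<alpha> i k + c \<alpha> i k > 0" using co i kk by auto
  ultimately show False using pos by (simp add: mult_le_0_iff)
qed

text \<open>The derivative bounds speak of mesh functions in the sector, while the mean value
  theorem yields a single vector \<open>q\<close>. Changing \<open>Ut\<close> to \<open>q\<close> at
  one mesh point gives a suitable mesh function.\<close>

lemma sector_partial:
  assumes ij: "i \<le> Nx" "j \<le> Ny"
    and q: "\<And>\<beta>. Uh \<beta> i j \<le> vec_nth q \<beta>" "\<And>\<beta>. vec_nth q \<beta> \<le> Ut \<beta> i j"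
  shows "partial_u (f \<alpha>) \<alpha> (xm Nx i, ym Ny j) q \<le> c \<alpha> i j"
    and "\<beta> \<noteq> \<alpha> \<Longrightarrow> partial_u (f \<alpha>) \<beta> (xm Nx i, ym Ny j) q \<le> 0"
proof -
  define U :: mesh_fun where
    "U = (\<lambda>\<beta> i' j'. if i' = i \<and> j' = j then vec_nth q \<beta> else Ut \<beta> i' j')"
  have "U \<in> sector Nx Ny Uh Ut"
    using q Uh_Ut unfolding sector_def leq_def by (auto simp: U_def mesh_def)
  moreover have "(\<chi> \<beta>. U \<beta> i j) = q" by (simp add: U_def Finite_Cartesian_Product.vec_eq_iff)
  moreover have "(i, j) \<in> mesh Nx Ny" using ij by (simp add: mesh_def)
  ultimately show "partial_u (f \<alpha>) \<alpha> (xm Nx i, ym Ny j) q \<le> c \<alpha> i j"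
    "\<beta> \<noteq> \<alpha> \<Longrightarrow> partial_u (f \<alpha>) \<beta> (xm Nx i, ym Ny j) q \<le> 0"
    using f_diag[of i j U \<alpha>] f_offdiag[of i j U \<beta> \<alpha>] by auto
qed

text \<open>Mean value theorem on the segment from \<open>V\<close> to \<open>V'\<close>: its
  direction is nonnegative, the diagonal derivative is at most \<open>c\<close> and the other one is
  nonpositive, so \<open>f\<close> grows by at most \<open>c\<close> times the growth of component
  \<open>\<alpha>\<close>.\<close>

lemma reaction_mono:
  assumes ij: "i \<le> Nx" "j \<le> Ny" and V: "leq Uh V" "leq V V'" "leq V' Ut"
  shows "c \<alpha> i j * V \<alpha> i j - ff \<alpha> V i j \<le> c \<alpha> i j * V' \<alpha> i j - ff \<alpha> V' i j"
proof -
  define p where "p = (xm Nx i, ym Ny j)"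
  define u w :: "real^2" where "u = (\<chi> \<beta>. V \<beta> i j)" and "w = (\<chi> \<beta>. V' \<beta> i j - V \<beta> i j)"
  have w: "vec_nth w \<beta> \<ge> 0" for \<beta> using V(2) ij by (simp add: w_def leq_def)
  define h where "h s = f \<alpha> (fst p, snd p, u + s *\<^sub>R w)" for s
  have "\<exists>z>0. z < 1 \<and> h 1 - h 0 =
      (1 - 0) * (\<Sum>\<beta>\<in>UNIV. vec_nth w \<beta> * partial_u (f \<alpha>) \<beta> p (u + z *\<^sub>R w))"
    unfolding h_def using mesh_point[OF ij]
    by (intro MVT2 smooth_on_line_derivative[OF f_smooth]) (simp_all add: p_def)
  then obtain z where z: "0 < z" "z < 1"
    and hz: "h 1 - h 0 = (\<Sum>\<beta>\<in>UNIV. vec_nth w \<beta> * partial_u (f \<alpha>) \<beta> p (u + z *\<^sub>R w))"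
    by auto
  \<comment> \<open>The intermediate point stays between \<open>Uh\<close> and \<open>Ut\<close>,
    where the derivative bounds hold.\<close>
  have lo: "Uh \<beta> i j \<le> vec_nth (u + z *\<^sub>R w) \<beta>" for \<beta>
  proof -
    have "Uh \<beta> i j \<le> vec_nth u \<beta>" using V(1) ij by (simp add: leq_def u_def)
    moreover have "0 \<le> z * vec_nth w \<beta>" using w z by simp
    ultimately show ?thesis by simp
  qed
  have hi: "vec_nth (u + z *\<^sub>R w) \<beta> \<le> Ut \<beta> i j" for \<beta>
  proof -
    have "z * vec_nth w \<beta> \<le> vec_nth w \<beta>" using w[of \<beta>] z by (simp add: mult_left_le_one_le)
    moreover have "vec_nth u \<beta> + vec_nth w \<beta> \<le> Ut \<beta> i j"
      using V(3) ij by (simp add: leq_def u_def w_def)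
    ultimately show ?thesis by simp
  qed
  have "h 1 - h 0 \<le> (\<Sum>\<beta>\<in>UNIV. if \<beta> = \<alpha> then c \<alpha> i j * vec_nth w \<beta> else 0)"
    unfolding hz
  proof (rule sum_mono)
    fix \<beta> :: 2
    show "vec_nth w \<beta> * partial_u (f \<alpha>) \<beta> p (u + z *\<^sub>R w)
        \<le> (if \<beta> = \<alpha> then c \<alpha> i j * vec_nth w \<beta> else 0)"
      using sector_partial[OF ij lo hi] w[of \<beta>]
      by (auto simp: p_def mult.commute[of "vec_nth w \<beta>"] intro!: mult_right_mono
          mult_nonpos_nonneg)
  qed
  also have "\<dots> = c \<alpha> i j * vec_nth w \<alpha>" by simp
  finally have "h 1 - h 0 \<le> c \<alpha> i j * (V' \<alpha> i j - V \<alpha> i j)" by (simp add: w_def)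
  moreover have "h 0 = ff \<alpha> V i j" by (simp add: h_def p_def u_def f_mesh_def)
  moreover have "u + w = (\<chi> \<beta>. V' \<beta> i j)" by (simp add: u_def w_def Finite_Cartesian_Product.vec_eq_iff)
  then have "h 1 = ff \<alpha> V' i j" by (simp add: h_def p_def f_mesh_def)
  ultimately show ?thesis by (simp add: algebra_simps)
qed

text \<open>\<open>c V\<close> and \<open>f\<close> are kept together, since only their difference
  is known to be monotone. \<open>Y\<close> is compared at the left neighbour alone, which is all
  that is available while sweeping.\<close>

lemma rhs_mono:
  assumes "inner i j" and V: "leq Uh V" "leq V V'" "leq V' Ut"
    and Y: "Y \<alpha> (i - 1) j \<le> Y' \<alpha> (i - 1) j"
  shows "rhs \<alpha> Y V i j \<le> rhs \<alpha> Y' V' i j"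
proof -
  have ij: "i < Nx" "j < Ny" using assms(1) by (auto simp: inner_def)
  note co = coef_nonneg[of i j \<alpha>]
  have "ll \<alpha> i j * Y \<alpha> (i - 1) j \<le> ll \<alpha> i j * Y' \<alpha> (i - 1) j"
    using Y co ij by (intro mult_left_mono) auto
  moreover have "rr \<alpha> i j * V \<alpha> (i + 1) j \<le> rr \<alpha> i j * V' \<alpha> (i + 1) j"
    using V(2) co ij by (intro mult_left_mono) (auto simp: leq_def)
  moreover have "c \<alpha> i j * V \<alpha> i j - ff \<alpha> V i j \<le> c \<alpha> i j * V' \<alpha> i j - ff \<alpha> V' i j"
    using reaction_mono[OF _ _ V] ij by simp
  ultimately show ?thesis by (simp add: rhs_def)
qed

section \<open>Comparison of steps and of whole sequences\<close>

text \<open>Induction from left to right over the grid lines, with \<open>row_compare\<close> on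
  each. Inequalities for \<open>X\<close> and \<open>X'\<close> let either be a sub- or
  supersolution instead of an iterate. The premise on \<open>Y\<close> may use the order of
  \<open>X\<close> and \<open>X'\<close> already proved on the previous line, as Gauss--Seidel
  requires.\<close>

lemma step_mono:
  assumes V: "leq Uh V" "leq V V'" "leq V' Ut"
    and bd: "\<And>\<alpha> i j. bdry i j \<Longrightarrow> X \<alpha> i j \<le> X' \<alpha> i j"
    and X: "\<And>\<alpha> i j. inner i j \<Longrightarrow> lhs \<alpha> X i j \<le> rhs \<alpha> Y V i j"
    and X': "\<And>\<alpha> i j. inner i j \<Longrightarrow> rhs \<alpha> Y' V' i j \<le> lhs \<alpha> X' i j"
    and Y: "\<And>\<alpha> i j. i < Nx \<Longrightarrow> j \<le> Ny \<Longrightarrow> X \<alpha> i j \<le> X' \<alpha> i j \<Longrightarrow> Y \<alpha> i j \<le> Y' \<alpha> i j"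
  shows "leq X X'"
proof -
  have "\<forall>j\<le>Ny. X \<alpha> i j \<le> X' \<alpha> i j" if "i \<le> Nx" for \<alpha> i
    using that
  proof (induction i)
    case 0
    then show ?case using bd by (simp add: bdry_def)
  next
    case (Suc i)
    show ?case
    proof (cases "Suc i = Nx")
      case True
      then show ?thesis using bd by (simp add: bdry_def)
    next
      case False
      then have i: "0 < Suc i" "Suc i < Nx" using Suc by auto
      have "lhs \<alpha> X (Suc i) j \<le> lhs \<alpha> X' (Suc i) j" if "0 < j" "j < Ny" for j
      proof -
        have inn: "inner (Suc i) j" using i that by (simp add: inner_def)
        \<comment> \<open>The induction hypothesis on line \<open>i\<close> provides the left
          neighbour of line \<open>Suc i\<close>.\<close>
        have "Y \<alpha> i j \<le> Y' \<alpha> i j" using Suc i that by (intro Y) auto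
        then have "rhs \<alpha> Y V (Suc i) j \<le> rhs \<alpha> Y' V' (Suc i) j"
          by (intro rhs_mono inn V) simp
        then show ?thesis using X[OF inn, of \<alpha>] X'[OF inn, of \<alpha>] by linarith
      qed
      moreover have "X \<alpha> (Suc i) 0 \<le> X' \<alpha> (Suc i) 0" "X \<alpha> (Suc i) Ny \<le> X' \<alpha> (Suc i) Ny"
        using bd i by (simp_all add: bdry_def)
      ultimately show ?thesis using row_compare[of "Suc i" X \<alpha> X', OF i] by blast
    qed
  qed
  then show ?thesis by (simp add: leq_def)
qed

text \<open>The bounds are proved jointly, since each comparison needs its arguments to lie in the
  sector.\<close>

lemma iterate_bounds:
  assumes u0: "super (u 0)" "leq (u 0) Ut" and l0: "sub (l 0)" "leq Uh (l 0)"
    and lu0: "leq (l 0) (u 0)"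
    and u: "\<And>n. step gs (u n) (u (Suc n))" and l: "\<And>n. step gs (l n) (l (Suc n))"
  shows "leq Uh (l n) \<and> leq (l n) (u n) \<and> leq (u n) Ut
    \<and> leq (u (Suc n)) (u n) \<and> leq (l n) (l (Suc n))"
proof (induction n)
  case 0
  have Uhu: "leq Uh (u 0)" and lUt: "leq (l 0) Ut"
    using leq_trans[OF l0(2) lu0] leq_trans[OF lu0 u0(2)] by simp_all
  \<comment> \<open>The supersolution \<open>u 0\<close> plays the role of \<open>X'\<close>,
    although no step produced it.\<close>
  have "leq (u (Suc 0)) (u 0)"
    by (rule step_mono[OF Uhu leq_refl u0(2), where Y' = "u 0"
          and Y = "if gs then u (Suc 0) else u 0"])
      (use u0(1) u[of 0] in \<open>auto simp: super_def step_def\<close>)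
  moreover have "leq (l 0) (l (Suc 0))"
    by (rule step_mono[OF l0(2) leq_refl lUt, where Y = "l 0"
          and Y' = "if gs then l (Suc 0) else l 0"])
      (use l0(1) l[of 0] in \<open>auto simp: sub_def step_def\<close>)
  ultimately show ?case using u0(2) l0(2) lu0 by simp
next
  case (Suc n)
  then have IH: "leq Uh (l n)" "leq (l n) (u n)" "leq (u n) Ut"
    "leq (u (Suc n)) (u n)" "leq (l n) (l (Suc n))" by auto
  \<comment> \<open>One step preserves order inside the sector; applied below to lower against upper
    and to consecutive iterates of each sequence.\<close>
  have gen: "leq X X'"
    if "leq Uh V" "leq V V'" "leq V' Ut" "step gs V X" "step gs V' X'" for V V' X X'
    by (rule step_mono[OF that(1-3), where Y = "if gs then X else V"
          and Y' = "if gs then X' else V'"])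
      (use that(2,4,5) in \<open>auto simp: step_def leq_def\<close>)
  have lu: "leq (l (Suc n)) (u (Suc n))" by (rule gen[OF IH(1-3) l u])
  have b: "leq Uh (l (Suc n))" "leq (u (Suc n)) Ut"
    using leq_trans[OF IH(1,5)] leq_trans[OF IH(4,3)] by simp_all
  have "leq (u (Suc (Suc n))) (u (Suc n))"
    by (rule gen[OF leq_trans[OF b(1) lu] IH(4) IH(3) u u])
  moreover have "leq (l (Suc n)) (l (Suc (Suc n)))"
    by (rule gen[OF IH(1) IH(5) leq_trans[OF lu b(2)] l l])
  ultimately show ?case using lu b by simp
qed

text \<open>Starting values are assumed ordered rather than equal, because completed block functions
  are controlled only on the mesh.\<close>

lemma jacobi_gauss_seidel_compare:
  assumes J0: "super (uJ 0)" "leq (uJ 0) Ut" "sub (lJ 0)" "leq Uh (lJ 0)"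
    and S0: "super (uS 0)" "leq (uS 0) Ut" "sub (lS 0)" "leq Uh (lS 0)"
    and ord: "leq (lJ 0) (lS 0)" "leq (lS 0) (uS 0)" "leq (uS 0) (uJ 0)"
    and uJ: "\<And>n. step False (uJ n) (uJ (Suc n))" and lJ: "\<And>n. step False (lJ n) (lJ (Suc n))"
    and uS: "\<And>n. step True (uS n) (uS (Suc n))" and lS: "\<And>n. step True (lS n) (lS (Suc n))"
  shows "leq (lJ n) (lS n) \<and> leq (lS n) (uS n) \<and> leq (uS n) (uJ n)"
proof -
  have S: "leq Uh (lS n)" "leq (lS n) (uS n)" "leq (uS n) Ut"
    "leq (uS (Suc n)) (uS n)" "leq (lS n) (lS (Suc n))" for n
    using iterate_bounds[OF S0 ord(2) uS lS] by simp_all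
  have lu0: "leq (lJ 0) (uJ 0)" by (rule leq_trans[OF leq_trans[OF ord(1,2)] ord(3)])
  have J: "leq Uh (lJ n)" "leq (uJ n) Ut" for n
    using iterate_bounds[OF J0 lu0 uJ lJ] by simp_all
  have "leq (uS n) (uJ n)"
  proof (induction n)
    case 0
    then show ?case using ord by simp
  next
    case (Suc n)
    \<comment> \<open>Monotone decrease of the Gauss--Seidel sequence makes its new left neighbour
      no larger than the old Jacobi one.\<close>
    have *: "leq (uS (Suc n)) (uJ n)" by (rule leq_trans[OF S(4) Suc])
    show ?case
      by (rule step_mono[OF leq_trans[OF S(1,2)] Suc J(2), where Y = "uS (Suc n)" and Y' = "uJ n"])
        (use * uJ[of n] uS[of n] in \<open>auto simp: step_def leq_def\<close>)
  qed
  moreover have "leq (lJ n) (lS n)"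
  proof (induction n)
    case 0
    then show ?case using ord by simp
  next
    case (Suc n)
    have *: "leq (lJ n) (lS (Suc n))" by (rule leq_trans[OF Suc S(5)])
    show ?case
      by (rule step_mono[OF J(1) Suc leq_trans[OF S(2,3)], where Y = "lJ n" and Y' = "lS (Suc n)"])
        (use * lJ[of n] lS[of n] in \<open>auto simp: step_def leq_def\<close>)
  qed
  ultimately show ?thesis using S(2) by simp
qed

section \<open>Upper and lower solutions as starting values\<close>

lemma diff_op_lhs:
  "diff_op Nx Ny eps v \<alpha> (X \<alpha>) i j + ff \<alpha> X i j = lhs \<alpha> X i j - rhs \<alpha> X X i j"
  unfolding diff_op_def lhs_def rhs_def d_coef_def l_coef_def r_coef_def b_coef_def t_coef_def
  by (simp add: diff_divide_distrib add_divide_distrib algebra_simps)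

lemma mesh_iff: "(i, j) \<in> mesh Nx Ny \<longleftrightarrow> i \<le> Nx \<and> j \<le> Ny"
  by (simp add: mesh_def)

lemma interior_iff: "(i, j) \<in> interior_mesh Nx Ny \<longleftrightarrow> inner i j"
  by (auto simp: interior_mesh_def inner_def)

lemma boundary_iff: "(i, j) \<in> boundary_mesh Nx Ny \<longleftrightarrow> bdry i j"
  by (auto simp: boundary_mesh_def mesh_iff interior_iff inner_def bdry_def)

lemma Uh_Ut_boundary: "bdry i j \<Longrightarrow> Uh \<alpha> i j \<le> gg \<alpha> i j \<and> gg \<alpha> i j \<le> Ut \<alpha> i j"
  using upper_lower unfolding ordered_upper_lower_def boundary_iff[symmetric] by blast

lemma Uh_Ut_inner:
  assumes "inner i j"
  shows "rhs \<alpha> Ut Ut i j \<le> lhs \<alpha> Ut i j" "lhs \<alpha> Uh i j \<le> rhs \<alpha> Uh Uh i j"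
proof -
  have "(i, j) \<in> interior_mesh Nx Ny" using assms interior_iff by simp
  then have "diff_op Nx Ny eps v \<alpha> (Ut \<alpha>) i j + ff \<alpha> Ut i j \<ge> 0"
    "diff_op Nx Ny eps v \<alpha> (Uh \<alpha>) i j + ff \<alpha> Uh i j \<le> 0"
    using upper_lower unfolding ordered_upper_lower_def by blast+
  then show "rhs \<alpha> Ut Ut i j \<le> lhs \<alpha> Ut i j" "lhs \<alpha> Uh i j \<le> rhs \<alpha> Uh Uh i j"
    unfolding diff_op_lhs by auto
qed

lemma extend_block:
  assumes "\<forall>\<alpha>. \<forall>i\<le>Nx. U \<alpha> i = block Ny (W \<alpha> i)" "i \<le> Nx" "j \<le> Ny"
  shows "ext U \<alpha> i j = (if j = 0 \<or> j = Ny then gg \<alpha> i j else W \<alpha> i j)"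
  using assms by (auto simp: extend_def block_def)

text \<open>Completion replaces \<open>W\<close> by \<open>g\<close> at \<open>j = 0\<close> and
  \<open>j = Ny\<close>. At inner points \<open>rhs\<close> reads no such value, and
  \<open>lhs\<close> reads them with nonpositive coefficients: lowering them raises
  \<open>lhs\<close>, so supersolutions survive, and dually for subsolutions.\<close>

lemma extend_initial:
  assumes U: "\<forall>\<alpha>. \<forall>i\<le>Nx. U \<alpha> i = block Ny (W \<alpha> i)" and ij: "inner i j"
  shows "rhs \<alpha> (ext U) (ext U) i j = rhs \<alpha> W W i j"
    and "(\<And>j. bdry i j \<Longrightarrow> gg \<alpha> i j \<le> W \<alpha> i j) \<Longrightarrow> lhs \<alpha> W i j \<le> lhs \<alpha> (ext U) i j"
    and "(\<And>j. bdry i j \<Longrightarrow> W \<alpha> i j \<le> gg \<alpha> i j) \<Longrightarrow> lhs \<alpha> (ext U) i j \<le> lhs \<alpha> W i j"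
proof -
  note e = extend_block[OF U]
  have i: "0 < i" "i < Nx" "0 < j" "j < Ny" using ij by (auto simp: inner_def)
  note co = coef_nonneg[of i j \<alpha>]
  have rhs_cong: "rhs \<alpha> X X i j = rhs \<alpha> W W i j"
    if "\<And>\<beta> i. i \<le> Nx \<Longrightarrow> X \<beta> i j = W \<beta> i j" for X
    using that i by (simp add: rhs_def f_mesh_def)
  show "rhs \<alpha> (ext U) (ext U) i j = rhs \<alpha> W W i j"
    by (rule rhs_cong) (use i in \<open>simp add: e\<close>)
  have mid: "ext U \<alpha> i j = W \<alpha> i j" using i by (simp add: e)
  show "lhs \<alpha> W i j \<le> lhs \<alpha> (ext U) i j" if bd: "\<And>j. bdry i j \<Longrightarrow> gg \<alpha> i j \<le> W \<alpha> i j"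
  proof -
    have "ext U \<alpha> i j' \<le> W \<alpha> i j'" if "j' \<le> Ny" for j'
      using e[of i j' \<alpha>] bd[of j'] i that by (simp add: bdry_def)
    from this[of "j - 1"] this[of "j + 1"] show ?thesis
      using mid i co unfolding lhs_def by (intro diff_mono mult_left_mono) (simp_all add: d_coef_def)
  qed
  show "lhs \<alpha> (ext U) i j \<le> lhs \<alpha> W i j" if bd: "\<And>j. bdry i j \<Longrightarrow> W \<alpha> i j \<le> gg \<alpha> i j"
  proof -
    have "W \<alpha> i j' \<le> ext U \<alpha> i j'" if "j' \<le> Ny" for j'
      using e[of i j' \<alpha>] bd[of j'] i that by (simp add: bdry_def)
    from this[of "j - 1"] this[of "j + 1"] show ?thesis
      using mid i co unfolding lhs_def by (intro diff_mono mult_left_mono) (simp_all add: d_coef_def)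
  qed
qed

lemma extend_upper:
  assumes U: "\<forall>\<alpha>. \<forall>i\<le>Nx. U \<alpha> i = block Ny (Ut \<alpha> i)"
  shows "super (ext U)" "leq (ext U) Ut"
proof -
  show "super (ext U)"
    unfolding super_def
  proof (intro allI conjI impI)
    fix \<alpha> i j assume "bdry i j"
    then show "gg \<alpha> i j \<le> ext U \<alpha> i j"
      using extend_block[OF U, of i j \<alpha>] Uh_Ut_boundary[of i j \<alpha>] by (auto simp: bdry_def)
  next
    fix \<alpha> i j assume "inner i j"
    then show "rhs \<alpha> (ext U) (ext U) i j \<le> lhs \<alpha> (ext U) i j"
      using extend_initial(1)[OF U, of i j \<alpha>] extend_initial(2)[OF U, of i j \<alpha>]
        Uh_Ut_inner(1)[of i j \<alpha>] Uh_Ut_boundary[of i _ \<alpha>] by fastforce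
  qed
  show "leq (ext U) Ut"
    using extend_block[OF U] Uh_Ut_boundary by (auto simp: leq_def bdry_def)
qed

lemma extend_lower:
  assumes U: "\<forall>\<alpha>. \<forall>i\<le>Nx. U \<alpha> i = block Ny (Uh \<alpha> i)"
  shows "sub (ext U)" "leq Uh (ext U)"
proof -
  show "sub (ext U)"
    unfolding sub_def
  proof (intro allI conjI impI)
    fix \<alpha> i j assume "bdry i j"
    then show "ext U \<alpha> i j \<le> gg \<alpha> i j"
      using extend_block[OF U, of i j \<alpha>] Uh_Ut_boundary[of i j \<alpha>] by (auto simp: bdry_def)
  next
    fix \<alpha> i j assume "inner i j"
    then show "lhs \<alpha> (ext U) i j \<le> rhs \<alpha> (ext U) (ext U) i j"
      using extend_initial(1)[OF U, of i j \<alpha>] extend_initial(3)[OF U, of i j \<alpha>]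
        Uh_Ut_inner(2)[of i j \<alpha>] Uh_Ut_boundary[of i _ \<alpha>] by fastforce
  qed
  show "leq Uh (ext U)"
    using extend_block[OF U] Uh_Ut_boundary by (auto simp: leq_def bdry_def)
qed

section \<open>Entries of the block matrices and of the residual\<close>

lemma A_mat_index:
  assumes "k < Ny - 1" "z \<in> carrier_vec (Ny - 1)"
  shows "(A_mat Nx Ny eps v \<alpha> i *\<^sub>v z) $ k = dd \<alpha> i (k + 1) * z $ k
    - (if k = 0 then 0 else bb \<alpha> i (k + 1) * z $ (k - 1))
    - (if k = Ny - 1 - 1 then 0 else tt \<alpha> i (k + 1) * z $ (k + 1))"
proof -
  have "(A_mat Nx Ny eps v \<alpha> i *\<^sub>v z) $ k = (\<Sum>m = 0..<Ny - 1. (if m = k then dd \<alpha> i (k + 1)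
      else if m + 1 = k then - bb \<alpha> i (k + 1) else if m = k + 1 then - tt \<alpha> i (k + 1) else 0) * z $ m)"
    using assms by (auto simp: A_mat_def scalar_prod_def intro!: sum.cong)
  also note tridiag_sum[OF assms(1)]
  finally show ?thesis .
qed

lemma diag_block_index:
  assumes "k < Ny - 1" "z \<in> carrier_vec (Ny - 1)"
  shows "(diag_block Ny w *\<^sub>v z) $ k = w (k + 1) * z $ k"
proof -
  have "(diag_block Ny w *\<^sub>v z) $ k = (\<Sum>m = 0..<Ny - 1. (if k = m then w (m + 1) else 0) * z $ m)"
    using assms by (auto simp: diag_block_def mat_diag_def scalar_prod_def intro!: sum.cong)
  also have "\<dots> = (\<Sum>m = 0..<Ny - 1. if k = m then w (m + 1) * z $ m else 0)"
    by (intro sum.cong) auto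
  also have "\<dots> = w (k + 1) * z $ k" using assms(1) by simp
  finally show ?thesis .
qed

text \<open>The neighbours missing from the first and last rows of \<open>A_mat\<close> are exactly
  the contributions of \<open>G_star\<close>, so on completed functions the residual is the
  pointwise defect.\<close>

lemma residual_index:
  assumes i: "0 < i" "i < Nx" and j: "0 < j" "j < Ny"
    and U: "\<And>\<beta> i. i \<le> Nx \<Longrightarrow> U \<beta> i \<in> carrier_vec (Ny - 1)"
  shows "residual Nx Ny eps v f g \<alpha> i U $ (j - 1) =
    lhs \<alpha> (ext U) i j - rhs \<alpha> (ext U) (ext U) i j"
proof -
  \<comment> \<open>\<open>G_star\<close> evaluates \<open>g\<close> at ordinates 0 and 1,
    \<open>ext\<close> at the mesh ordinates.\<close>
  have [simp]: "ym Ny 0 = 0" "ym Ny Ny = 1" using Ny by (auto simp: ym_def hy_def)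
  obtain k where k: "j = Suc k" using j by (cases j) auto
  have kN: "k < Ny - 1" using j k by simp
  have dims: "dim_row (A_mat Nx Ny eps v \<alpha> i) = Ny - 1" "dim_row (L_mat Nx Ny eps v \<alpha> i) = Ny - 1"
    "dim_row (R_mat Nx Ny eps \<alpha> i) = Ny - 1"
    "dim_vec (F_block Nx Ny f \<alpha> i U) = Ny - 1" "dim_vec (G_star Nx Ny eps v g \<alpha> i) = Ny - 1"
    by (simp_all add: A_mat_def L_mat_def R_mat_def diag_block_def mat_diag_def F_block_def
        G_star_def block_def)
  have e: "ext U \<beta> i' j = U \<beta> i' $ k" for \<beta> i' using j k by (simp add: extend_def)
  have jk: "j - 1 = k" using k by simp
  have F: "F_block Nx Ny f \<alpha> i U $ k = ff \<alpha> (ext U) i j"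
    unfolding F_block_def f_mesh_def e using kN k by simp
  have G: "G_star Nx Ny eps v g \<alpha> i $ k = (if k = 0 then bb \<alpha> i j * g \<alpha> (xm Nx i, 0) else 0)
      + (if k = Ny - 1 - 1 then tt \<alpha> i j * g \<alpha> (xm Nx i, 1) else 0)"
    using kN k by (auto simp: G_star_def block_def)
  have down: "ext U \<alpha> i (j - 1) = (if k = 0 then g \<alpha> (xm Nx i, 0) else U \<alpha> i $ (k - 1))"
    using k kN by (auto simp: extend_def)
  have up: "ext U \<alpha> i (j + 1) = (if k = Ny - 1 - 1 then g \<alpha> (xm Nx i, 1) else U \<alpha> i $ (k + 1))"
  proof (cases "k = Ny - 1 - 1")
    case True
    then have "j + 1 = Ny" using k kN by simp
    then show ?thesis using True by (simp add: extend_def)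
  qed (use k kN in \<open>auto simp: extend_def\<close>)
  \<comment> \<open>The neighbour terms are split into the same conditionals as in
    \<open>A_mat_index\<close> and \<open>G\<close>, which the final linear arithmetic treats as
    atoms.\<close>
  have down': "bb \<alpha> i j * ext U \<alpha> i (j - 1) = (if k = 0 then 0 else bb \<alpha> i j * U \<alpha> i $ (k - 1))
      + (if k = 0 then bb \<alpha> i j * g \<alpha> (xm Nx i, 0) else 0)"
    unfolding down by simp
  have up': "tt \<alpha> i j * ext U \<alpha> i (j + 1)
      = (if k = Ny - 1 - 1 then 0 else tt \<alpha> i j * U \<alpha> i $ (k + 1))
      + (if k = Ny - 1 - 1 then tt \<alpha> i j * g \<alpha> (xm Nx i, 1) else 0)"
    unfolding up by simp
  have "residual Nx Ny eps v f g \<alpha> i U $ k =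
      (A_mat Nx Ny eps v \<alpha> i *\<^sub>v U \<alpha> i) $ k - (L_mat Nx Ny eps v \<alpha> i *\<^sub>v U \<alpha> (i - 1)) $ k
      - (R_mat Nx Ny eps \<alpha> i *\<^sub>v U \<alpha> (i + 1)) $ k + F_block Nx Ny f \<alpha> i U $ k
      - G_star Nx Ny eps v g \<alpha> i $ k"
    using kN by (simp add: residual_def dims del: index_mult_mat_vec)
  also have "(A_mat Nx Ny eps v \<alpha> i *\<^sub>v U \<alpha> i) $ k = dd \<alpha> i j * U \<alpha> i $ k
    - (if k = 0 then 0 else bb \<alpha> i j * U \<alpha> i $ (k - 1))
    - (if k = Ny - 1 - 1 then 0 else tt \<alpha> i j * U \<alpha> i $ (k + 1))"
    using A_mat_index[OF kN, of "U \<alpha> i" \<alpha> i] U i k by simp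
  also have "(L_mat Nx Ny eps v \<alpha> i *\<^sub>v U \<alpha> (i - 1)) $ k = ll \<alpha> i j * U \<alpha> (i - 1) $ k"
    unfolding L_mat_def using diag_block_index[OF kN U] i k by simp
  also have "(R_mat Nx Ny eps \<alpha> i *\<^sub>v U \<alpha> (i + 1)) $ k = rr \<alpha> i j * U \<alpha> (i + 1) $ k"
    unfolding R_mat_def using diag_block_index[OF kN U] i k by simp
  finally show ?thesis
    unfolding lhs_def rhs_def F G e down' up' distrib_right unfolding jk by linarith
qed

section \<open>From the block equations to pointwise steps\<close>

lemma increments_Suc:
  assumes inc: "increments Nx Ny g U Z"
  shows "i \<le> Nx \<Longrightarrow> Z (Suc n) \<alpha> i \<in> carrier_vec (Ny - 1)"
    and "i \<le> Nx \<Longrightarrow> U (Suc n) \<alpha> i = U n \<alpha> i + Z (Suc n) \<alpha> i"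
    and "i = 0 \<or> i = Nx \<Longrightarrow>
      Z (Suc n) \<alpha> i = (if n = 0 then g_block Nx Ny g \<alpha> i - U 0 \<alpha> i else 0\<^sub>v (Ny - 1))"
proof -
  have "Suc n \<ge> 1" by simp
  with inc have *: "(\<forall>i\<le>Nx. Z (Suc n) \<alpha> i \<in> carrier_vec (Ny - 1) \<and>
      U (Suc n) \<alpha> i = U (Suc n - 1) \<alpha> i + Z (Suc n) \<alpha> i) \<and>
     (\<forall>i\<in>{0, Nx}. Z (Suc n) \<alpha> i =
        (if Suc n = 1 then g_block Nx Ny g \<alpha> i - U 0 \<alpha> i else 0\<^sub>v (Ny - 1)))"
    unfolding increments_def by blast
  show "i \<le> Nx \<Longrightarrow> Z (Suc n) \<alpha> i \<in> carrier_vec (Ny - 1)"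
    "i \<le> Nx \<Longrightarrow> U (Suc n) \<alpha> i = U n \<alpha> i + Z (Suc n) \<alpha> i"
    "i = 0 \<or> i = Nx \<Longrightarrow>
      Z (Suc n) \<alpha> i = (if n = 0 then g_block Nx Ny g \<alpha> i - U 0 \<alpha> i else 0\<^sub>v (Ny - 1))"
    using * by auto
qed

lemma increments_carrier:
  assumes inc: "increments Nx Ny g U Z" and init: "initial_blocks Nx Ny W U"
  shows "i \<le> Nx \<Longrightarrow> U n \<alpha> i \<in> carrier_vec (Ny - 1)"
proof (induction n)
  case 0
  then show ?case using init by (simp add: initial_blocks_def block_def)
next
  case (Suc n)
  then show ?case
    using increments_Suc(1)[OF inc, of i n \<alpha>] increments_Suc(2)[OF inc, of i n \<alpha>] by simp
qed

text \<open>The first increment corrects the end blocks to \<open>g\<close> and all later ones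
  vanish there, so the boundary condition holds from iterate 1 on.\<close>

lemma increments_boundary:
  assumes inc: "increments Nx Ny g U Z" and init: "initial_blocks Nx Ny W U"
    and i: "i = 0 \<or> i = Nx"
  shows "U (Suc n) \<alpha> i = g_block Nx Ny g \<alpha> i"
proof (induction n)
  case 0
  have "i \<le> Nx" using i by auto
  from increments_carrier[OF inc init this] have "U 0 \<alpha> i \<in> carrier_vec (Ny - 1)" .
  moreover have "g_block Nx Ny g \<alpha> i \<in> carrier_vec (Ny - 1)"
    by (simp add: g_block_def block_def)
  ultimately show ?case
    unfolding increments_Suc(2)[OF inc \<open>i \<le> Nx\<close>] increments_Suc(3)[OF inc i]
    by (intro eq_vecI) auto
next
  case (Suc n)
  have "i \<le> Nx" using i by auto
  have "g_block Nx Ny g \<alpha> i + 0\<^sub>v (Ny - 1) = g_block Nx Ny g \<alpha> i"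
    by (rule right_zero_vec) (simp add: g_block_def block_def)
  then show ?case
    using increments_Suc(2)[OF inc \<open>i \<le> Nx\<close>, of "Suc n" \<alpha>] increments_Suc(3)[OF inc i, of "Suc n" \<alpha>]
      Suc by simp
qed

text \<open>With \<open>Z\<close> written as the difference of consecutive iterates, the
  \<open>A\<close> and \<open>C\<close> terms of the old iterate cancel against the residual. For
  Gauss--Seidel the \<open>L\<close> term also trades the old left neighbour for the new
  one.\<close>

lemma increments_step:
  assumes inc: "increments Nx Ny g U Z" and init: "initial_blocks Nx Ny W U"
    and eq: "\<And>\<alpha> i. 0 < i \<Longrightarrow> i < Nx \<Longrightarrow>
        A_mat Nx Ny eps v \<alpha> i *\<^sub>v Z (Suc n) \<alpha> i
          - (if gs then L_mat Nx Ny eps v \<alpha> i *\<^sub>v Z (Suc n) \<alpha> (i - 1) else 0\<^sub>v (Ny - 1))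
          + C_mat Ny c \<alpha> i *\<^sub>v Z (Suc n) \<alpha> i
        = - residual Nx Ny eps v f g \<alpha> i (U n)"
  shows "step gs (ext (U n)) (ext (U (Suc n)))"
  unfolding step_def
proof (intro allI conjI impI)
  fix \<alpha> i j assume b: "bdry i j"
  show "ext (U (Suc n)) \<alpha> i j = gg \<alpha> i j"
  proof (cases "j = 0 \<or> j = Ny")
    case False
    then show ?thesis using b increments_boundary[OF inc init, of i n \<alpha>]
      by (auto simp: bdry_def extend_def g_block_def block_def)
  qed (auto simp: extend_def)
next
  fix \<alpha> i j assume "inner i j"
  then have i: "0 < i" "i < Nx" and j: "0 < j" "j < Ny" by (auto simp: inner_def)
  obtain k where k: "j = Suc k" using j by (cases j) auto
  have kN: "k < Ny - 1" "Suc k \<noteq> Ny" using j k by simp_all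
  have U: "U m \<beta> i' \<in> carrier_vec (Ny - 1)" if "i' \<le> Nx" for m \<beta> i'
    using increments_carrier[OF inc init that] .
  have Z: "Z (Suc n) \<beta> i' \<in> carrier_vec (Ny - 1)"
    "U (Suc n) \<beta> i' = U n \<beta> i' + Z (Suc n) \<beta> i'" if "i' \<le> Nx" for \<beta> i'
    using increments_Suc(1,2)[OF inc that] by simp_all
  have Zk: "Z (Suc n) \<beta> i' $ m = U (Suc n) \<beta> i' $ m - U n \<beta> i' $ m"
    if "i' \<le> Nx" "m < Ny - 1" for \<beta> i' m
    using Z[OF that(1), of \<beta>] that(2) by auto
  let ?X = "ext (U (Suc n))" and ?V = "ext (U n)" and ?z = "Z (Suc n) \<alpha> i"
  have dims: "dim_row (A_mat Nx Ny eps v \<alpha> i) = Ny - 1" "dim_row (L_mat Nx Ny eps v \<alpha> i) = Ny - 1"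
    "dim_row (C_mat Ny c \<alpha> i) = Ny - 1"
    by (simp_all add: A_mat_def L_mat_def C_mat_def diag_block_def mat_diag_def)
  have dim_res: "dim_vec (residual Nx Ny eps v f g \<alpha> i (U n)) = Ny - 1"
    by (simp add: residual_def G_star_def block_def)
  \<comment> \<open>Both completions equal \<open>g\<close> at \<open>j = 0\<close> and
    \<open>j = Ny\<close>, so their difference vanishes there, matching the truncated first and last
    rows.\<close>
  have A: "(A_mat Nx Ny eps v \<alpha> i *\<^sub>v ?z) $ k = dd \<alpha> i j * (?X \<alpha> i j - ?V \<alpha> i j)
      - bb \<alpha> i j * (?X \<alpha> i (j - 1) - ?V \<alpha> i (j - 1)) - tt \<alpha> i j * (?X \<alpha> i (j + 1) - ?V \<alpha> i (j + 1))"
    using A_mat_index[where z = ?z and \<alpha> = \<alpha> and i = i, OF kN(1) Z(1)] i kN k by (auto simp: Zk extend_def)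
  have L: "(L_mat Nx Ny eps v \<alpha> i *\<^sub>v Z (Suc n) \<alpha> (i - 1)) $ k
      = ll \<alpha> i j * (?X \<alpha> (i - 1) j - ?V \<alpha> (i - 1) j)"
    unfolding L_mat_def using diag_block_index[where z = "Z (Suc n) \<alpha> (i - 1)", OF kN(1) Z(1)] i kN k
    by (simp add: Zk extend_def)
  have C: "(C_mat Ny c \<alpha> i *\<^sub>v ?z) $ k = c \<alpha> i j * (?X \<alpha> i j - ?V \<alpha> i j)"
    unfolding C_mat_def using diag_block_index[where z = ?z, OF kN(1) Z(1)] i kN k
    by (simp add: Zk extend_def)
  have R: "residual Nx Ny eps v f g \<alpha> i (U n) $ k = lhs \<alpha> ?V i j - rhs \<alpha> ?V ?V i j"
    using residual_index[OF i j U] k by simp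
  have "(A_mat Nx Ny eps v \<alpha> i *\<^sub>v ?z
          - (if gs then L_mat Nx Ny eps v \<alpha> i *\<^sub>v Z (Suc n) \<alpha> (i - 1) else 0\<^sub>v (Ny - 1))
          + C_mat Ny c \<alpha> i *\<^sub>v ?z) $ k
      = (A_mat Nx Ny eps v \<alpha> i *\<^sub>v ?z) $ k
        - (if gs then (L_mat Nx Ny eps v \<alpha> i *\<^sub>v Z (Suc n) \<alpha> (i - 1)) $ k else 0)
        + (C_mat Ny c \<alpha> i *\<^sub>v ?z) $ k"
    using kN by (simp add: dims del: index_mult_mat_vec)
  moreover have "(- residual Nx Ny eps v f g \<alpha> i (U n)) $ k
      = - (residual Nx Ny eps v f g \<alpha> i (U n) $ k)"
    using kN dim_res by simp
  ultimately have "(A_mat Nx Ny eps v \<alpha> i *\<^sub>v ?z) $ k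
        - (if gs then (L_mat Nx Ny eps v \<alpha> i *\<^sub>v Z (Suc n) \<alpha> (i - 1)) $ k else 0)
        + (C_mat Ny c \<alpha> i *\<^sub>v ?z) $ k = - (residual Nx Ny eps v f g \<alpha> i (U n) $ k)"
    using eq[OF i, of \<alpha>] by simp
  then show "lhs \<alpha> ?X i j = rhs \<alpha> (if gs then ?X else ?V) ?V i j"
    unfolding A L C R by (simp add: lhs_def rhs_def algebra_simps split: if_splits)
qed

lemma block_jacobi_step:
  assumes "block_jacobi Nx Ny eps v f g c W U"
  shows "\<forall>\<alpha>. \<forall>i\<le>Nx. U 0 \<alpha> i = block Ny (W \<alpha> i)"
    and "step False (ext (U n)) (ext (U (Suc n)))"
    and "i \<le> Nx \<Longrightarrow> U n \<alpha> i \<in> carrier_vec (Ny - 1)"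
proof -
  obtain Z where init: "initial_blocks Nx Ny W U" and inc: "increments Nx Ny g U Z"
    and eq: "\<forall>n\<ge>1. \<forall>\<alpha>. \<forall>i\<in>{1..Nx - 1}. A_mat Nx Ny eps v \<alpha> i *\<^sub>v Z n \<alpha> i
      + C_mat Ny c \<alpha> i *\<^sub>v Z n \<alpha> i = - residual Nx Ny eps v f g \<alpha> i (U (n - 1))"
    using assms unfolding block_jacobi_def by blast
  show "\<forall>\<alpha>. \<forall>i\<le>Nx. U 0 \<alpha> i = block Ny (W \<alpha> i)"
    using init by (simp add: initial_blocks_def)
  show "i \<le> Nx \<Longrightarrow> U n \<alpha> i \<in> carrier_vec (Ny - 1)"
    using increments_carrier[OF inc init] .
  show "step False (ext (U n)) (ext (U (Suc n)))"
  proof (rule increments_step[OF inc init])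
    fix \<alpha> i assume i: "0 < i" "i < Nx"
    \<comment> \<open>A zero vector stands in for the absent \<open>L\<close> term, so that one
      lemma covers both methods.\<close>
    have "A_mat Nx Ny eps v \<alpha> i *\<^sub>v Z (Suc n) \<alpha> i - 0\<^sub>v (Ny - 1)
        = A_mat Nx Ny eps v \<alpha> i *\<^sub>v Z (Suc n) \<alpha> i"
      by (intro eq_vecI) (auto simp: A_mat_def)
    moreover have "i \<in> {1..Nx - 1}" using i by auto
    ultimately show "A_mat Nx Ny eps v \<alpha> i *\<^sub>v Z (Suc n) \<alpha> i
          - (if False then L_mat Nx Ny eps v \<alpha> i *\<^sub>v Z (Suc n) \<alpha> (i - 1) else 0\<^sub>v (Ny - 1))
          + C_mat Ny c \<alpha> i *\<^sub>v Z (Suc n) \<alpha> i = - residual Nx Ny eps v f g \<alpha> i (U n)"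
      using eq[rule_format, of "Suc n" i \<alpha>] by simp
  qed
qed

lemma block_gauss_seidel_step:
  assumes "block_gauss_seidel Nx Ny eps v f g c W U"
  shows "\<forall>\<alpha>. \<forall>i\<le>Nx. U 0 \<alpha> i = block Ny (W \<alpha> i)"
    and "step True (ext (U n)) (ext (U (Suc n)))"
    and "i \<le> Nx \<Longrightarrow> U n \<alpha> i \<in> carrier_vec (Ny - 1)"
proof -
  obtain Z where init: "initial_blocks Nx Ny W U" and inc: "increments Nx Ny g U Z"
    and eq: "\<forall>n\<ge>1. \<forall>\<alpha>. \<forall>i\<in>{1..Nx - 1}. A_mat Nx Ny eps v \<alpha> i *\<^sub>v Z n \<alpha> i
      - L_mat Nx Ny eps v \<alpha> i *\<^sub>v Z n \<alpha> (i - 1)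
      + C_mat Ny c \<alpha> i *\<^sub>v Z n \<alpha> i = - residual Nx Ny eps v f g \<alpha> i (U (n - 1))"
    using assms unfolding block_gauss_seidel_def by blast
  show "\<forall>\<alpha>. \<forall>i\<le>Nx. U 0 \<alpha> i = block Ny (W \<alpha> i)"
    using init by (simp add: initial_blocks_def)
  show "i \<le> Nx \<Longrightarrow> U n \<alpha> i \<in> carrier_vec (Ny - 1)"
    using increments_carrier[OF inc init] .
  show "step True (ext (U n)) (ext (U (Suc n)))"
  proof (rule increments_step[OF inc init])
    fix \<alpha> i assume "0 < i" "i < Nx"
    then show "A_mat Nx Ny eps v \<alpha> i *\<^sub>v Z (Suc n) \<alpha> i
          - (if True then L_mat Nx Ny eps v \<alpha> i *\<^sub>v Z (Suc n) \<alpha> (i - 1) else 0\<^sub>v (Ny - 1))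
          + C_mat Ny c \<alpha> i *\<^sub>v Z (Suc n) \<alpha> i = - residual Nx Ny eps v f g \<alpha> i (U n)"
      using eq[rule_format, of "Suc n" i \<alpha>] by simp
  qed
qed

section \<open>Return to blocks and conclusion\<close>

text \<open>The order on vectors also demands equal dimensions, hence the carrier premises.\<close>

lemma block_le:
  assumes "leq (ext U) (ext V)" "i \<le> Nx"
    and "U \<alpha> i \<in> carrier_vec (Ny - 1)" "V \<alpha> i \<in> carrier_vec (Ny - 1)"
  shows "U \<alpha> i \<le> V \<alpha> i"
proof -
  have "U \<alpha> i $ k \<le> V \<alpha> i $ k" if "k < Ny - 1" for k
  proof -
    have "ext U \<alpha> i (Suc k) \<le> ext V \<alpha> i (Suc k)"
      using assms(1,2) that by (simp add: leq_def)
    then show ?thesis using that by (simp add: extend_def split: if_splits)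
  qed
  then show ?thesis using assms(3,4) by (simp add: less_eq_vec_def)
qed

end

theorem theorem4:
  fixes Nx Ny :: nat
    and eps :: "2 \<Rightarrow> real"
    and v :: "2 \<Rightarrow> real \<times> real \<Rightarrow> real"
    and f :: "2 \<Rightarrow> real \<times> real \<times> (real^2) \<Rightarrow> real"
    and g :: "2 \<Rightarrow> real \<times> real \<Rightarrow> real"
    and c :: "2 \<Rightarrow> nat \<Rightarrow> nat \<Rightarrow> real"
    and Ut Uh :: mesh_fun
    and upJ loJ upGS loGS :: "nat \<Rightarrow> block_fun"
  assumes "Nx \<ge> 1" and "Ny \<ge> 1"
    and "\<And>\<alpha>. eps \<alpha> > 0"
    and "\<And>\<alpha>. smooth_on (v \<alpha>) (closure omega)"
    and "\<And>\<alpha> p. p \<in> closure omega \<Longrightarrow> v \<alpha> p \<ge> 0"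
    and "\<And>\<alpha>. smooth_on (f \<alpha>) {(x, y, u). (x, y) \<in> closure omega}"
    and "\<And>\<alpha>. smooth_on (g \<alpha>) (frontier omega)"
    and "ordered_upper_lower Nx Ny eps v f g Ut Uh"
    and "\<And>\<alpha> i j. (i, j) \<in> mesh Nx Ny \<Longrightarrow> c \<alpha> i j \<ge> 0"
    and "\<And>\<alpha>. bounded ((\<lambda>(i, j). c \<alpha> i j) ` mesh Nx Ny)"
    and "\<And>\<alpha> i j U. (i, j) \<in> mesh Nx Ny \<Longrightarrow> U \<in> sector Nx Ny Uh Ut \<Longrightarrow>
           partial_u (f \<alpha>) \<alpha> (xm Nx i, ym Ny j) (\<chi> \<beta>. U \<beta> i j) \<le> c \<alpha> i j"
    and "\<And>\<alpha> \<alpha>' i j U. (i, j) \<in> mesh Nx Ny \<Longrightarrow> U \<in> sector Nx Ny Uh Ut \<Longrightarrow> \<alpha>' \<noteq> \<alpha> \<Longrightarrow>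
           - partial_u (f \<alpha>) \<alpha>' (xm Nx i, ym Ny j) (\<chi> \<beta>. U \<beta> i j) \<ge> 0"
    and "block_jacobi Nx Ny eps v f g c Ut upJ"
    and "block_jacobi Nx Ny eps v f g c Uh loJ"
    and "block_gauss_seidel Nx Ny eps v f g c Ut upGS"
    and "block_gauss_seidel Nx Ny eps v f g c Uh loGS"
  shows "\<forall>n. \<forall>i\<le>Nx. \<forall>\<alpha>.
           loJ n \<alpha> i \<le> loGS n \<alpha> i \<and> loGS n \<alpha> i \<le> upGS n \<alpha> i \<and> upGS n \<alpha> i \<le> upJ n \<alpha> i"
proof -
  interpret block_scheme Nx Ny eps v f g c Ut Uh
    using assms(1-3,5,6,8,9,11,12) by unfold_locales
  note uJ = block_jacobi_step[OF assms(13)] and lJ = block_jacobi_step[OF assms(14)]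
    and uS = block_gauss_seidel_step[OF assms(15)] and lS = block_gauss_seidel_step[OF assms(16)]
  \<comment> \<open>On the mesh, starts from the same function have identical completions; lower and
    upper ones agree with \<open>g\<close> at \<open>j = 0\<close> and \<open>j = Ny\<close> and are
    ordered by \<open>Uh_Ut\<close> elsewhere.\<close>
  have ord: "leq (ext (loJ 0)) (ext (loGS 0))" "leq (ext (loGS 0)) (ext (upGS 0))"
    "leq (ext (upGS 0)) (ext (upJ 0))"
    using Uh_Ut by (auto simp: leq_def extend_block[OF uJ(1)] extend_block[OF lJ(1)]
        extend_block[OF uS(1)] extend_block[OF lS(1)])
  have "leq (ext (loJ n)) (ext (loGS n)) \<and> leq (ext (loGS n)) (ext (upGS n))
      \<and> leq (ext (upGS n)) (ext (upJ n))" for n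
    using jacobi_gauss_seidel_compare[of "\<lambda>n. ext (upJ n)" "\<lambda>n. ext (loJ n)"
        "\<lambda>n. ext (upGS n)" "\<lambda>n. ext (loGS n)" n]
      extend_upper[OF uJ(1)] extend_lower[OF lJ(1)] extend_upper[OF uS(1)] extend_lower[OF lS(1)]
      ord uJ(2) lJ(2) uS(2) lS(2) by blast
  then show ?thesis using block_le uJ(3) lJ(3) uS(3) lS(3) by blast
qed

end
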